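(* Let $(X,d)$ be a (nonempty) geodesic space. Then the following are equivalent: (1) $\operatorname{UBG}(X)=\operatorname{UBG}(\mathbb{R})$. (2) $X$ is isometric to an interval (a convex subset of $\mathbb{R}$) which is not the single-point space.
   Context: All graphs are finite, simple and undirected. A geodesic from $x$ to $y$ in a metric space $(X,d)$ is a distance-preserving map $\gamma\colon[0,d(x,y)]\to X$ with $\gamma(0)=x$, $\gamma(d(x,y))=y$; $(X,d)$ is a geodesic space if every two points are joined by a geodesic. A graph $G=(V_G,E_G)$ is a unit ball graph on $(X,d)$ if there exist $\delta>0$ and a map $\rho\colon V_G\to X$ such that for distinct $u,v\in V_G$, $\{u,v\}\in E_G$ if and only if $d(\rho(u),\rho(v))\le\delta$. $\operatorname{UBG}(X)$ denotes the collection of all unit ball graphs on $X$. $\mathbb{R}$ carries its usual metric. *)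

theory Defs
  imports "HOL-Analysis.Analysis" "HOL-Library.Infinite_Typeclass"
begin

type_synonym 'v graph = "'v set \<times> 'v set set"

definition simple_graph :: "'v graph \<Rightarrow> bool" where
  "simple_graph G \<longleftrightarrow> (case G of (V, E) \<Rightarrow>
     finite V \<and> (\<forall>e\<in>E. \<exists>u\<in>V. \<exists>v\<in>V. u \<noteq> v \<and> e = {u, v}))"

definition geodesic :: "'a metric \<Rightarrow> 'a \<Rightarrow> 'a \<Rightarrow> (real \<Rightarrow> 'a) \<Rightarrow> bool" where
  "geodesic X x y \<gamma> \<longleftrightarrow>
     \<gamma> \<in> {0..mdist X x y} \<rightarrow> mspace X \<and>
     (\<forall>s\<in>{0..mdist X x y}. \<forall>t\<in>{0..mdist X x y}. mdist X (\<gamma> s) (\<gamma> t) = dist s t) \<and>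
     \<gamma> 0 = x \<and> \<gamma> (mdist X x y) = y"

definition geodesic_space :: "'a metric \<Rightarrow> bool" where
  "geodesic_space X \<longleftrightarrow> (\<forall>x\<in>mspace X. \<forall>y\<in>mspace X. \<exists>\<gamma>. geodesic X x y \<gamma>)"

definition unit_ball_graph :: "'a metric \<Rightarrow> 'v graph \<Rightarrow> bool" where
  "unit_ball_graph X G \<longleftrightarrow> simple_graph G \<and> (case G of (V, E) \<Rightarrow>
     \<exists>\<delta>>0. \<exists>\<rho>. \<rho> \<in> V \<rightarrow> mspace X \<and>
       (\<forall>u\<in>V. \<forall>v\<in>V. u \<noteq> v \<longrightarrow> ({u, v} \<in> E \<longleftrightarrow> mdist X (\<rho> u) (\<rho> v) \<le> \<delta>)))"

text \<open>The proper class of all unit ball graphs is represented by those with vertices in a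
  type \<open>'v\<close>. Being a unit ball graph is invariant under isomorphism, so nothing is lost
  when \<open>'v\<close> is infinite: every finite graph then has an isomorphic copy on \<open>'v\<close>.\<close>

definition UBG :: "'a metric \<Rightarrow> ('v::infinite) graph set" where
  "UBG X = {G. unit_ball_graph X G}"

definition isometric :: "'a metric \<Rightarrow> 'b metric \<Rightarrow> bool" where
  "isometric X Y \<longleftrightarrow> (\<exists>f. bij_betw f (mspace X) (mspace Y) \<and>
     (\<forall>x\<in>mspace X. \<forall>y\<in>mspace X. mdist Y (f x) (f y) = mdist X x y))"

end

theory Submission
  imports Defs
begin

text \<open>Applied to a fine discretization of geodesics, a realization \<open>\<rho>\<close> on the line orders any three
  points; if \<open>y\<close> is in the middle, the discretized geodesic from \<open>x\<close> to \<open>z\<close> must jump over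
  \<open>\<rho> y\<close> in a step of at most the threshold, so it has a vertex within one threshold of \<open>y\<close>. Letting the mesh
  tend to 0, every triple is collinear. Menger's only obstruction to embedding such a space in the
  line is the four-cycle with equal opposite sides, and a midpoint of a side excludes it. Conversely,
  a finite subset of the line rescales into any nondegenerate interval.\<close>

section \<open>Points and discrete chains on geodesics\<close>

lemma geodesic_space_point_at:
  assumes "geodesic_space X" "x \<in> mspace X" "y \<in> mspace X" "0 \<le> t" "t \<le> mdist X x y"
  obtains w where "w \<in> mspace X" "mdist X x w = t" "mdist X w y = mdist X x y - t"
proof -
  obtain \<gamma> where g: "geodesic X x y \<gamma>"
    using assms unfolding geodesic_space_def by blast
  let ?L = "mdist X x y"
  have "0 \<in> {0..?L}" "?L \<in> {0..?L}" "t \<in> {0..?L}"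
    using assms(4,5) by auto
  with g have "\<gamma> t \<in> mspace X" "mdist X (\<gamma> 0) (\<gamma> t) = dist 0 t" "mdist X (\<gamma> t) (\<gamma> ?L) = dist t ?L"
    "\<gamma> 0 = x" "\<gamma> ?L = y"
    unfolding geodesic_def by (blast+)
  with that[of "\<gamma> t"] assms(4,5) show ?thesis
    by (auto simp: dist_real_def)
qed

text \<open>Sample a geodesic at equally spaced parameters. The samples stay on the geodesic, so the
  triangle inequality through each of them is an equality; this is what later turns closeness to a
  sample into almost-betweenness.\<close>

lemma geodesic_space_chain:
  assumes "geodesic_space X" "x \<in> mspace X" "y \<in> mspace X" "0 < \<delta>"
  obtains p :: "nat \<Rightarrow> 'a" and n where "p 0 = x" "p n = y" "\<And>i. i \<le> n \<Longrightarrow> p i \<in> mspace X"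
    "\<And>i. i < n \<Longrightarrow> mdist X (p i) (p (Suc i)) \<le> \<delta>" "n > 0"
    "\<And>i. i \<le> n \<Longrightarrow> mdist X x (p i) + mdist X (p i) y = mdist X x y"
proof -
  obtain \<gamma> where g: "geodesic X x y \<gamma>"
    using assms unfolding geodesic_space_def by blast
  define L where "L = mdist X x y"
  have L0: "0 \<le> L" unfolding L_def by (rule mdist_nonneg)
  \<comment> \<open>The strict bound makes \<open>n\<close> positive even when \<open>x = y\<close>,
    as \<open>discrete_crossing\<close> will require.\<close>
  obtain n where n: "L / \<delta> < real n" using reals_Archimedean2 by blast
  have n0: "n > 0" using n L0 assms(4) by (metis divide_nonneg_pos gr0I leD of_nat_0)
  have step: "L / n \<le> \<delta>" using n n0 assms(4) by (simp add: field_simps)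
  define p where "p i = \<gamma> (L * (i / n))" for i :: nat
  have m: "L * (i / n) \<in> {0..L}" if "i \<le> n" for i :: nat
    using that n0 mult_left_le[of "i / n" L] L0 by auto
  have d: "mdist X (p i) (p j) = \<bar>L * (i / n) - L * (j / n)\<bar>" if "i \<le> n" "j \<le> n" for i j
    using g m[OF that(1)] m[OF that(2)] unfolding geodesic_def p_def L_def
    by (simp add: dist_real_def)
  have p0: "p 0 = x" and pn: "p n = y"
    using g n0 unfolding geodesic_def p_def L_def by auto
  show ?thesis
  proof (rule that[of p n])
    show "p i \<in> mspace X" if "i \<le> n" for i
      using g m[OF that] unfolding geodesic_def p_def L_def by blast
    show "mdist X (p i) (p (Suc i)) \<le> \<delta>" if "i < n" for i
    proof -
      have "mdist X (p i) (p (Suc i)) = \<bar>L * (i / n) - L * (Suc i / n)\<bar>"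
        using d[of i "Suc i"] that by simp
      also have "\<dots> = \<bar>- (L / n)\<bar>"
        by (rule arg_cong[where f = abs]) (use n0 in \<open>simp add: field_simps\<close>)
      finally show ?thesis using step L0 by simp
    qed
    show "mdist X x (p i) + mdist X (p i) y = mdist X x y" if "i \<le> n" for i
      using d[of 0 i] d[of i n] that m[OF that] n0 p0 pn L_def by simp
  qed (use p0 pn n0 in auto)
qed

text \<open>A discrete intermediate value theorem: some step of the sequence passes over
  \<open>c\<close>. Only the resulting bound on the distance from \<open>c\<close> to the start of
  that step is kept, because a graph can merely compare distances with its threshold.\<close>

lemma discrete_crossing:
  fixes g :: "nat \<Rightarrow> real"
  assumes "g 0 \<le> c \<and> c \<le> g n \<or> g n \<le> c \<and> c \<le> g 0" "n > 0"
  shows "\<exists>i<n. \<bar>c - g i\<bar> \<le> \<bar>g (Suc i) - g i\<bar>"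
proof -
  have up: "\<exists>i<n. h i \<le> b \<and> b \<le> h (Suc i)" if "h 0 \<le> b" "b \<le> h n" "n > 0"
    for h :: "nat \<Rightarrow> real" and b and n :: nat
    using that
  proof (induction n)
    case (Suc n)
    show ?case
    \<comment> \<open>Either an earlier step already crosses \<open>b\<close>, or the last one does;
      for \<open>n = 0\<close> the last step is the only one.\<close>
    proof (cases "n > 0 \<and> b \<le> h n")
      case True
      then show ?thesis using Suc less_Suc_eq by blast
    next
      case False
      then show ?thesis using Suc.prems by (intro exI[of _ n]) auto
    qed
  qed simp
  from assms(1) show ?thesis
  proof
    assume "g 0 \<le> c \<and> c \<le> g n"
    then obtain i where "i < n" "g i \<le> c" "c \<le> g (Suc i)" using up[of g c n] assms(2) by blast
    then show ?thesis by (intro exI[of _ i]) auto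
  next
    assume "g n \<le> c \<and> c \<le> g 0"
    then obtain i where "i < n" "- g i \<le> - c" "- c \<le> - g (Suc i)"
      using up[of "\<lambda>i. - g i" "- c" n] assms(2) by auto
    then show ?thesis by (intro exI[of _ i]) auto
  qed
qed

section \<open>From realizations on the line to collinear triples\<close>

text \<open>Graphs in \<open>UBG\<close> have vertices in \<open>'v\<close>, so \<open>S\<close> is
  first copied into that type; a realization on the line is then pulled back along the copy
  \<open>h\<close>.\<close>

lemma UBG_real_finite_realization:
  assumes sub: "(UBG X :: ('v::infinite) graph set) \<subseteq> UBG (euclidean_metric :: real metric)"
    and S: "finite S" "S \<subseteq> mspace X" and \<delta>: "0 < \<delta>"
  obtains r :: "'a \<Rightarrow> real" and \<epsilon> where
    "\<And>u v. u \<in> S \<Longrightarrow> v \<in> S \<Longrightarrow> mdist X u v \<le> \<delta> \<longleftrightarrow> \<bar>r u - r v\<bar> \<le> \<epsilon>"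
proof -
  obtain W :: "'v set" where W: "finite W" "card W = card S"
    using infinite_arbitrarily_large[OF infinite_UNIV] by blast
  then obtain h where h: "bij_betw h S W"
    using S(1) finite_same_card_bij by metis
  define k where "k = inv_into S h"
  define E where "E = {{h u, h v} | u v. u \<in> S \<and> v \<in> S \<and> u \<noteq> v \<and> mdist X u v \<le> \<delta>}"
  have kh: "k (h u) = u" if "u \<in> S" for u
    using that h unfolding k_def by (simp add: bij_betw_def)
  have hW: "h u \<in> W" if "u \<in> S" for u using that h by (auto simp: bij_betw_def)
  have inj: "h u = h v \<longleftrightarrow> u = v" if "u \<in> S" "v \<in> S" for u v using that kh by metis
  have Wh: "\<exists>u\<in>S. w = h u" if "w \<in> W" for w using that h by (auto simp: bij_betw_def)
  have E: "{h u, h v} \<in> E \<longleftrightarrow> mdist X u v \<le> \<delta>" if "u \<in> S" "v \<in> S" "u \<noteq> v" for u v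
  proof
    assume "{h u, h v} \<in> E"
    then obtain a b where "{h u, h v} = {h a, h b}" "a \<in> S" "b \<in> S" "mdist X a b \<le> \<delta>"
      unfolding E_def by blast
    \<comment> \<open>The unordered pairs may match in either order, so symmetry of the metric
      enters.\<close>
    then show "mdist X u v \<le> \<delta>"
      using that inj by (metis doubleton_eq_iff mdist_commute)
  qed (use that in \<open>auto simp: E_def\<close>)
  have "simple_graph (W, E)"
    unfolding simple_graph_def E_def using W(1) hW inj by fastforce
  moreover have "k \<in> W \<rightarrow> mspace X" using Wh kh S(2) by fastforce
  moreover have "\<forall>u\<in>W. \<forall>v\<in>W. u \<noteq> v \<longrightarrow> ({u, v} \<in> E \<longleftrightarrow> mdist X (k u) (k v) \<le> \<delta>)"
  proof (intro ballI impI)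
    fix u v assume "u \<in> W" "v \<in> W" "u \<noteq> v"
    then obtain a b where "a \<in> S" "b \<in> S" "u = h a" "v = h b" "a \<noteq> b" using Wh by metis
    then show "{u, v} \<in> E \<longleftrightarrow> mdist X (k u) (k v) \<le> \<delta>" using E kh by simp
  qed
  ultimately have "(W, E) \<in> UBG X"
    using \<delta> unfolding UBG_def unit_ball_graph_def by auto
  with sub have "(W, E) \<in> UBG (euclidean_metric :: real metric)" by blast
  then obtain \<epsilon> r where r: "\<epsilon> > 0"
    "\<And>u v. u \<in> W \<Longrightarrow> v \<in> W \<Longrightarrow> u \<noteq> v \<Longrightarrow> ({u, v} \<in> E \<longleftrightarrow> dist (r u) (r v :: real) \<le> \<epsilon>)"
    unfolding UBG_def unit_ball_graph_def by auto
  show ?thesis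
  proof (rule that[of "r \<circ> h" \<epsilon>])
    fix u v assume uv: "u \<in> S" "v \<in> S"
    show "mdist X u v \<le> \<delta> \<longleftrightarrow> \<bar>(r \<circ> h) u - (r \<circ> h) v\<bar> \<le> \<epsilon>"
    \<comment> \<open>The graph says nothing about equal points; there both sides hold, since the
      distances vanish and both thresholds are positive.\<close>
    proof (cases "u = v")
      case True
      then have "mdist X u v = 0" using uv S(2) mdist_zero[of u X v] by auto
      then show ?thesis using True \<delta> r(1) by simp
    next
      case False
      then show ?thesis
        using r(2)[of "h u" "h v"] E[OF uv] inj[OF uv] hW uv by (simp add: dist_real_def)
    qed
  qed
qed

text \<open>\<open>T\<close> is fixed before \<open>r\<close>, \<open>\<epsilon>\<close> and
  \<open>c\<close>, so that the sets for several pairs can be merged before a realization is chosen.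
  The vertex of \<open>T\<close> found near \<open>c\<close> lies on a geodesic from
  \<open>a\<close> to \<open>b\<close>, and the detour through it costs at most
  \<open>\<delta>\<close> on each side.\<close>

lemma geodesic_space_between_witness:
  assumes geo: "geodesic_space X" and a: "a \<in> mspace X" and b: "b \<in> mspace X" and \<delta>: "0 < \<delta>"
  obtains T where "finite T" "T \<subseteq> mspace X" "a \<in> T" "b \<in> T"
    "\<forall>(r :: 'a \<Rightarrow> real) \<epsilon>. \<forall>c\<in>mspace X.
      (\<forall>u\<in>insert c T. \<forall>v\<in>insert c T. mdist X u v \<le> \<delta> \<longleftrightarrow> \<bar>r u - r v\<bar> \<le> \<epsilon>) \<longrightarrow>
      r a \<le> r c \<and> r c \<le> r b \<or> r b \<le> r c \<and> r c \<le> r a \<longrightarrow>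
      mdist X a c + mdist X c b \<le> mdist X a b + 2 * \<delta>"
proof -
  obtain p n where p: "p 0 = a" "p n = b" "\<And>i. i \<le> n \<Longrightarrow> p i \<in> mspace X"
    "\<And>i. i < n \<Longrightarrow> mdist X (p i) (p (Suc i)) \<le> \<delta>" "n > (0::nat)"
    "\<And>i. i \<le> n \<Longrightarrow> mdist X a (p i) + mdist X (p i) b = mdist X a b"
    using geodesic_space_chain[OF geo a b \<delta>] by blast
  show ?thesis
  proof (rule that[of "p ` {..n}"], goal_cases)
    case 5
    show ?case
    proof (intro allI ballI impI)
      fix r :: "'a \<Rightarrow> real" and \<epsilon> c
      assume c: "c \<in> mspace X"
        and r: "\<forall>u\<in>insert c (p ` {..n}). \<forall>v\<in>insert c (p ` {..n}).
          mdist X u v \<le> \<delta> \<longleftrightarrow> \<bar>r u - r v\<bar> \<le> \<epsilon>"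
        and btw: "r a \<le> r c \<and> r c \<le> r b \<or> r b \<le> r c \<and> r c \<le> r a"
      obtain i where i: "i < n" "\<bar>r c - r (p i)\<bar> \<le> \<bar>r (p (Suc i)) - r (p i)\<bar>"
        using discrete_crossing[of "\<lambda>i. r (p i)" "r c" n] btw p(1,2,5) by auto
      \<comment> \<open>The threshold equivalence is used in both directions: a short step in
        \<open>X\<close> gives a short step on the line, and closeness of \<open>r c\<close> on the
        line gives closeness of \<open>c\<close> in \<open>X\<close>.\<close>
      have "\<bar>r (p i) - r (p (Suc i))\<bar> \<le> \<epsilon>"
        using r p(4)[OF i(1)] i(1) by auto
      then have "\<bar>r c - r (p i)\<bar> \<le> \<epsilon>" using i(2) by linarith
      then have "mdist X c (p i) \<le> \<delta>" using r i(1) by auto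
      moreover have pi: "p i \<in> mspace X" using p(3) i(1) by simp
      ultimately show "mdist X a c + mdist X c b \<le> mdist X a b + 2 * \<delta>"
        using mdist_triangle[OF a pi c] mdist_triangle[OF c pi b] p(6)[of i] i(1)
          mdist_commute[of X c "p i"] by linarith
    qed
  qed (use p(1,2,3) in \<open>auto intro: rev_image_eqI\<close>)
qed

text \<open>The disjuncts correspond to \<open>y\<close>, \<open>x\<close> and \<open>z\<close>
  having the middle image on the line. Which one is in the middle is known only once
  \<open>r\<close> is given, so a single finite set has to contain chains for all three
  pairs.\<close>

lemma UBG_real_approx_collinear:
  assumes sub: "(UBG X :: ('v::infinite) graph set) \<subseteq> UBG (euclidean_metric :: real metric)"
    and geo: "geodesic_space X"
    and x: "x \<in> mspace X" and y: "y \<in> mspace X" and z: "z \<in> mspace X" and \<delta>: "0 < \<delta>"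
  shows "mdist X x y + mdist X y z \<le> mdist X x z + 2 * \<delta> \<or>
         mdist X y x + mdist X x z \<le> mdist X y z + 2 * \<delta> \<or>
         mdist X x z + mdist X z y \<le> mdist X x y + 2 * \<delta>"
proof -
  obtain A where A: "finite A" "A \<subseteq> mspace X" "x \<in> A" "z \<in> A" and
    A': "\<forall>(r :: 'a \<Rightarrow> real) \<epsilon>. \<forall>c\<in>mspace X.
      (\<forall>u\<in>insert c A. \<forall>v\<in>insert c A. mdist X u v \<le> \<delta> \<longleftrightarrow> \<bar>r u - r v\<bar> \<le> \<epsilon>) \<longrightarrow>
      r x \<le> r c \<and> r c \<le> r z \<or> r z \<le> r c \<and> r c \<le> r x \<longrightarrow>
      mdist X x c + mdist X c z \<le> mdist X x z + 2 * \<delta>"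
    by (rule geodesic_space_between_witness[OF geo x z \<delta>])
  obtain B where B: "finite B" "B \<subseteq> mspace X" "y \<in> B" "z \<in> B" and
    B': "\<forall>(r :: 'a \<Rightarrow> real) \<epsilon>. \<forall>c\<in>mspace X.
      (\<forall>u\<in>insert c B. \<forall>v\<in>insert c B. mdist X u v \<le> \<delta> \<longleftrightarrow> \<bar>r u - r v\<bar> \<le> \<epsilon>) \<longrightarrow>
      r y \<le> r c \<and> r c \<le> r z \<or> r z \<le> r c \<and> r c \<le> r y \<longrightarrow>
      mdist X y c + mdist X c z \<le> mdist X y z + 2 * \<delta>"
    by (rule geodesic_space_between_witness[OF geo y z \<delta>])
  obtain C where C: "finite C" "C \<subseteq> mspace X" "x \<in> C" "y \<in> C" and
    C': "\<forall>(r :: 'a \<Rightarrow> real) \<epsilon>. \<forall>c\<in>mspace X.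
      (\<forall>u\<in>insert c C. \<forall>v\<in>insert c C. mdist X u v \<le> \<delta> \<longleftrightarrow> \<bar>r u - r v\<bar> \<le> \<epsilon>) \<longrightarrow>
      r x \<le> r c \<and> r c \<le> r y \<or> r y \<le> r c \<and> r c \<le> r x \<longrightarrow>
      mdist X x c + mdist X c y \<le> mdist X x y + 2 * \<delta>"
    by (rule geodesic_space_between_witness[OF geo x y \<delta>])
  define S where "S = A \<union> B \<union> C"
  have "finite S" "S \<subseteq> mspace X" using A B C unfolding S_def by auto
  then obtain r :: "'a \<Rightarrow> real" and \<epsilon> where
    r: "\<And>u v. u \<in> S \<Longrightarrow> v \<in> S \<Longrightarrow> mdist X u v \<le> \<delta> \<longleftrightarrow> \<bar>r u - r v\<bar> \<le> \<epsilon>"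
    using UBG_real_finite_realization[OF sub _ _ \<delta>] by blast
  have sub: "insert y A \<subseteq> S" "insert x B \<subseteq> S" "insert z C \<subseteq> S"
    using A B C unfolding S_def by auto
  consider "r x \<le> r y \<and> r y \<le> r z \<or> r z \<le> r y \<and> r y \<le> r x"
    | "r y \<le> r x \<and> r x \<le> r z \<or> r z \<le> r x \<and> r x \<le> r y"
    | "r x \<le> r z \<and> r z \<le> r y \<or> r y \<le> r z \<and> r z \<le> r x"
    by linarith
  then show ?thesis
  proof cases
    case 1
    have "\<forall>u\<in>insert y A. \<forall>v\<in>insert y A. mdist X u v \<le> \<delta> \<longleftrightarrow> \<bar>r u - r v\<bar> \<le> \<epsilon>"
      using r sub(1) by auto
    with A' y 1 show ?thesis by blast
  next
    case 2
    have "\<forall>u\<in>insert x B. \<forall>v\<in>insert x B. mdist X u v \<le> \<delta> \<longleftrightarrow> \<bar>r u - r v\<bar> \<le> \<epsilon>"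
      using r sub(2) by auto
    with B' x 2 show ?thesis by blast
  next
    case 3
    have "\<forall>u\<in>insert z C. \<forall>v\<in>insert z C. mdist X u v \<le> \<delta> \<longleftrightarrow> \<bar>r u - r v\<bar> \<le> \<epsilon>"
      using r sub(3) by auto
    with C' z 3 show ?thesis by blast
  qed
qed

text \<open>Menger's condition for the line: every three points embed isometrically in the
  reals.\<close>

definition collinear_triples :: "'a metric \<Rightarrow> bool" where
  "collinear_triples X \<longleftrightarrow> (\<forall>x\<in>mspace X. \<forall>y\<in>mspace X. \<forall>z\<in>mspace X.
     mdist X x z = mdist X x y + mdist X y z \<or>
     mdist X y z = mdist X x y + mdist X x z \<or>
     mdist X x y = mdist X x z + mdist X y z)"

lemma collinear_triplesD:
  "collinear_triples X \<Longrightarrow> x \<in> mspace X \<Longrightarrow> y \<in> mspace X \<Longrightarrow> z \<in> mspace X \<Longrightarrow>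
     mdist X x z = mdist X x y + mdist X y z \<or>
     mdist X y z = mdist X x y + mdist X x z \<or>
     mdist X x y = mdist X x z + mdist X y z"
  unfolding collinear_triples_def by blast

text \<open>The disjunct that holds approximately may change with \<open>\<delta>\<close>, so no
  limit is taken in a single one. Instead, if all three triangle inequalities were strict, one small
  \<open>\<delta>\<close> would violate every disjunct at once.\<close>

lemma UBG_real_collinear_triples:
  assumes sub: "(UBG X :: ('v::infinite) graph set) \<subseteq> UBG (euclidean_metric :: real metric)"
    and geo: "geodesic_space X"
  shows "collinear_triples X"
  unfolding collinear_triples_def
proof (intro ballI)
  fix x y z assume xyz: "x \<in> mspace X" "y \<in> mspace X" "z \<in> mspace X"
  let ?a = "mdist X x y + mdist X y z - mdist X x z"
  let ?b = "mdist X x y + mdist X x z - mdist X y z"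
  let ?c = "mdist X x z + mdist X y z - mdist X x y"
  have nn: "?a \<ge> 0" "?b \<ge> 0" "?c \<ge> 0"
    using mdist_triangle[of x X y z] mdist_triangle[of y X x z] mdist_triangle[of x X z y] xyz
      mdist_commute[of X x y] mdist_commute[of X y z] by auto
  have "\<not> (?a > 0 \<and> ?b > 0 \<and> ?c > 0)"
  proof
    \<comment> \<open>A third of the least defect, so that \<open>2 * \<delta>\<close> is below all
      three.\<close>
    define \<delta> where "\<delta> = min ?a (min ?b ?c) / 3"
    assume "?a > 0 \<and> ?b > 0 \<and> ?c > 0"
    then have \<delta>: "\<delta> > 0" "2 * \<delta> < ?a" "2 * \<delta> < ?b" "2 * \<delta> < ?c"
      unfolding \<delta>_def by (simp_all add: min_def split: if_splits)
    show False
      using UBG_real_approx_collinear[OF sub geo xyz \<delta>(1)] \<delta>(2-4)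
        mdist_commute[of X x y] mdist_commute[of X y z] by linarith
  qed
  with nn show "mdist X x z = mdist X x y + mdist X y z \<or>
     mdist X y z = mdist X x y + mdist X x z \<or> mdist X x y = mdist X x z + mdist X y z"
    by linarith
qed

section \<open>Isometric embedding into the line\<close>

text \<open>In the four-cycle \<open>p q r s\<close> all triples are collinear, so a fifth point is
  needed. The midpoint \<open>w\<close> of \<open>p\<close> and \<open>q\<close> is equally far from
  \<open>r\<close> and \<open>s\<close>, and the isosceles triangle \<open>w r s\<close> is not
  degenerate.\<close>

lemma no_pseudolinear_quadruple:
  assumes geo: "geodesic_space X" and col: "collinear_triples X"
    and p: "p \<in> mspace X" "q \<in> mspace X" "r \<in> mspace X" "s \<in> mspace X"
    and pos: "0 < \<alpha>" "0 < \<beta>"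
    and d: "mdist X p q = \<alpha>" "mdist X r s = \<alpha>" "mdist X q r = \<beta>" "mdist X p s = \<beta>"
      "mdist X p r = \<alpha> + \<beta>" "mdist X q s = \<alpha> + \<beta>"
  shows False
proof -
  obtain w where w: "w \<in> mspace X" "mdist X p w = \<alpha> / 2" "mdist X w q = \<alpha> / 2"
    using geodesic_space_point_at[OF geo p(1,2), of "\<alpha> / 2"] pos d(1) by auto
  \<comment> \<open>The path through \<open>q\<close> bounds the distance from above, the diagonal
    from \<open>p\<close> to \<open>r\<close> from below.\<close>
  have "mdist X w r = \<alpha> / 2 + \<beta>"
    using mdist_triangle[OF w(1) p(2,3)] mdist_triangle[OF p(1) w(1) p(3)] w d by linarith
  moreover have "mdist X w s = \<alpha> / 2 + \<beta>"
    using mdist_triangle[OF w(1) p(1,4)] mdist_triangle[OF p(2) w(1) p(4)] w d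
      mdist_commute[of X w] by auto
  ultimately show False
    using collinear_triplesD[OF col w(1) p(3,4)] d(2) pos by linarith
qed

text \<open>Use the signed distance from \<open>a\<close> as coordinate. If it fails for a pair
  \<open>x\<close>, \<open>y\<close>, collinearity with \<open>a\<close> and with \<open>b\<close>
  makes the two coordinates mirror images about \<open>D / 2\<close>, and \<open>a\<close>,
  \<open>b\<close>, \<open>x\<close>, \<open>y\<close> form the forbidden four-cycle or coincide in
  coordinates.\<close>

lemma collinear_triples_embedding:
  assumes geo: "geodesic_space X" and col: "collinear_triples X"
    and a: "a \<in> mspace X" and b: "b \<in> mspace X" and ab: "a \<noteq> b"
  obtains f :: "'a \<Rightarrow> real" where
    "\<And>x y. x \<in> mspace X \<Longrightarrow> y \<in> mspace X \<Longrightarrow> \<bar>f x - f y\<bar> = mdist X x y"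
proof -
  define D where "D = mdist X a b"
  have D: "D > 0"
    using mdist_nonneg[of X a b] mdist_zero[OF a b] ab unfolding D_def by linarith
  \<comment> \<open>The sign is negative when \<open>a\<close> lies between \<open>b\<close> and
    \<open>x\<close>; thus \<open>a\<close> goes to 0 and \<open>b\<close> to
    \<open>D\<close>.\<close>
  define f where "f x = (if mdist X b x = D + mdist X a x then - mdist X a x else mdist X a x)" for x
  have fa: "mdist X a x = \<bar>f x\<bar>" for x
    using mdist_nonneg[of X a x] unfolding f_def by auto
  have fb: "mdist X b x = \<bar>f x - D\<bar>" if "x \<in> mspace X" for x
    using collinear_triplesD[OF col a b that] D mdist_nonneg[of X a x] mdist_nonneg[of X b x]
    unfolding f_def D_def[symmetric] by (smt (verit))
  have "\<bar>f x - f y\<bar> = mdist X x y" if x: "x \<in> mspace X" and y: "y \<in> mspace X" for x y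
  proof (rule ccontr)
    assume neq: "\<bar>f x - f y\<bar> \<noteq> mdist X x y"
    \<comment> \<open>Given the distances from \<open>a\<close>, a collinear triple leaves only the
      difference and the sum of the coordinates; the difference is excluded by
      \<open>neq\<close>.\<close>
    have 1: "mdist X x y = \<bar>f x + f y\<bar>"
      using collinear_triplesD[OF col a x y] neq mdist_nonneg[of X x y] unfolding fa by linarith
    have 2: "mdist X x y = \<bar>f x - D + (f y - D)\<bar>"
      using collinear_triplesD[OF col b x y] neq mdist_nonneg[of X x y]
      unfolding fb[OF x] fb[OF y] by linarith
    \<comment> \<open>The numbers \<open>f x + f y\<close> and \<open>f x + f y - 2 * D\<close>
      differ but have equal absolute value, so they are opposite.\<close>
    have s: "f y = D - f x" using 1 2 D by linarith
    have d: "mdist X a x = \<bar>f x\<bar>" "mdist X a y = \<bar>D - f x\<bar>" "mdist X b x = \<bar>D - f x\<bar>"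
        "mdist X b y = \<bar>f x\<bar>" "mdist X x y = D" "mdist X a b = D"
      using fa[of x] fa[of y] fb[OF x] fb[OF y] 1 D unfolding s D_def by auto
    \<comment> \<open>At 0 and \<open>D\<close> the difference of coordinates is \<open>D\<close> in
      absolute value, against \<open>neq\<close>. Elsewhere the position of \<open>f x\<close>
      decides the cyclic order of the four points.\<close>
    consider "f x < 0" | "f x = 0" | "0 < f x" "f x < D" | "f x = D" | "D < f x" by linarith
    then show False
    proof cases
      case 1
      show False
        by (rule no_pseudolinear_quadruple[OF geo col a b y x, of D "- f x"])
          (use 1 d D mdist_commute[of X] in auto)
    next
      case 3
      show False
        by (rule no_pseudolinear_quadruple[OF geo col a x b y, of "f x" "D - f x"])
          (use 3 d D mdist_commute[of X] in auto)
    next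
      case 5
      show False
        by (rule no_pseudolinear_quadruple[OF geo col a b x y, of D "f x - D"])
          (use 5 d D mdist_commute[of X] in auto)
    qed (use neq s d(5) D in auto)
  qed
  then show ?thesis by (rule that)
qed

lemma geodesic_space_embedding_convex:
  assumes geo: "geodesic_space X"
    and f: "\<And>x y. x \<in> mspace X \<Longrightarrow> y \<in> mspace X \<Longrightarrow> \<bar>f x - f y\<bar> = mdist X x y"
  shows "convex (f ` mspace X :: real set)"
  unfolding is_interval_convex_1[symmetric] is_interval_1
proof (intro ballI allI impI)
  fix u v c assume uv: "u \<in> f ` mspace X" "v \<in> f ` mspace X" and c: "u \<le> c \<and> c \<le> v"
  then obtain x y where xy: "x \<in> mspace X" "y \<in> mspace X" "u = f x" "v = f y" by blast
  have L: "mdist X x y = f y - f x" using f[OF xy(1,2)] c xy by linarith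
  obtain w where w: "w \<in> mspace X" "mdist X x w = c - u" "mdist X w y = mdist X x y - (c - u)"
    using geodesic_space_point_at[OF geo xy(1,2), of "c - u"] c xy L by auto
  \<comment> \<open>Each distance alone leaves up to two candidates for \<open>f w\<close>; only
    \<open>c\<close> fits both.\<close>
  have "f w = c"
    using f[OF xy(1) w(1)] f[OF w(1) xy(2)] w L xy c by linarith
  then show "c \<in> f ` mspace X" using w(1) by blast
qed

section \<open>Unit ball graphs of intervals\<close>

lemma UBG_subset_isometric:
  assumes "isometric X Y"
  shows "(UBG X :: ('v::infinite) graph set) \<subseteq> UBG Y"
proof
  fix G :: "'v graph" assume G: "G \<in> UBG X"
  obtain V E where [simp]: "G = (V, E)" by (cases G)
  obtain f where f: "bij_betw f (mspace X) (mspace Y)"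
    "\<forall>x\<in>mspace X. \<forall>y\<in>mspace X. mdist Y (f x) (f y) = mdist X x y"
    using assms unfolding isometric_def by blast
  obtain \<delta> \<rho> where *: "simple_graph G" "\<delta> > 0" "\<rho> \<in> V \<rightarrow> mspace X"
    "\<forall>u\<in>V. \<forall>v\<in>V. u \<noteq> v \<longrightarrow> ({u, v} \<in> E \<longleftrightarrow> mdist X (\<rho> u) (\<rho> v) \<le> \<delta>)"
    using G unfolding UBG_def unit_ball_graph_def by auto
  have "f \<circ> \<rho> \<in> V \<rightarrow> mspace Y" using bij_betwE[OF f(1)] *(3) by auto
  moreover have "mdist Y (f (\<rho> u)) (f (\<rho> v)) = mdist X (\<rho> u) (\<rho> v)" if "u \<in> V" "v \<in> V" for u v
    using that f(2) *(3) by blast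
  ultimately show "G \<in> UBG Y"
    using *(1,2,4) unfolding UBG_def unit_ball_graph_def by (auto intro!: exI[of _ \<delta>] exI[of _ "f \<circ> \<rho>"])
qed

lemma isometric_sym:
  assumes "isometric X Y"
  shows "isometric Y X"
proof -
  obtain f where f: "bij_betw f (mspace X) (mspace Y)"
    "\<forall>x\<in>mspace X. \<forall>y\<in>mspace X. mdist Y (f x) (f y) = mdist X x y"
    using assms unfolding isometric_def by blast
  let ?g = "inv_into (mspace X) f"
  have g: "bij_betw ?g (mspace Y) (mspace X)" by (rule bij_betw_inv_into[OF f(1)])
  have "mdist X (?g x) (?g y) = mdist Y x y" if "x \<in> mspace Y" "y \<in> mspace Y" for x y
    using f(2)[rule_format, of "?g x" "?g y"] bij_betwE[OF g] that
    by (simp add: bij_betw_inv_into_right[OF f(1)])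
  with g show ?thesis unfolding isometric_def by blast
qed

text \<open>A realization in \<open>I\<close> is already one in the reals. Conversely, a finite
  vertex set has bounded image, and an affine map squeezes it into \<open>I\<close> while scaling
  the threshold by the same factor.\<close>

lemma UBG_interval_eq_UBG_real:
  fixes I :: "real set"
  assumes "convex I" "a \<in> I" "b \<in> I" "a < b"
  shows "(UBG (submetric euclidean_metric I) :: ('v::infinite) graph set) =
    UBG (euclidean_metric :: real metric)"
proof (intro equalityI subsetI)
  fix G :: "'v graph" assume "G \<in> UBG (submetric euclidean_metric I)"
  moreover obtain V E where [simp]: "G = (V, E)" by (cases G)
  ultimately obtain \<delta> and \<rho> :: "'v \<Rightarrow> real" where "simple_graph G" "\<delta> > 0"
    "\<forall>u\<in>V. \<forall>v\<in>V. u \<noteq> v \<longrightarrow> ({u, v} \<in> E \<longleftrightarrow> dist (\<rho> u) (\<rho> v) \<le> \<delta>)"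
    unfolding UBG_def unit_ball_graph_def by auto
  then show "G \<in> UBG (euclidean_metric :: real metric)"
    unfolding UBG_def unit_ball_graph_def by (auto intro!: exI[of _ \<delta>] exI[of _ \<rho>])
next
  fix G :: "'v graph" assume G: "G \<in> UBG (euclidean_metric :: real metric)"
  obtain V E where [simp]: "G = (V, E)" by (cases G)
  obtain \<delta> and \<rho> :: "'v \<Rightarrow> real" where *: "simple_graph G" "\<delta> > 0"
    "\<And>u v. u \<in> V \<Longrightarrow> v \<in> V \<Longrightarrow> u \<noteq> v \<Longrightarrow> ({u, v} \<in> E \<longleftrightarrow> dist (\<rho> u) (\<rho> v) \<le> \<delta>)"
    using G unfolding UBG_def unit_ball_graph_def by auto
  have "finite V" using *(1) by (simp add: simple_graph_def)
  then have "bounded (\<rho> ` V)" by (simp add: finite_imp_bounded)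
  then obtain M where M: "M > 0" "\<And>v. v \<in> V \<Longrightarrow> \<bar>\<rho> v\<bar> \<le> M"
    unfolding bounded_pos by auto
  \<comment> \<open>The scale at which the interval from \<open>- M\<close> to \<open>M\<close> is
    carried onto the one from \<open>a\<close> to \<open>b\<close>.\<close>
  define k where "k = (b - a) / (2 * M)"
  have k: "k > 0" unfolding k_def using M(1) assms(4) by simp
  define r where "r v = a + k * (\<rho> v + M)" for v
  have "r v \<in> I" if "v \<in> V" for v
  proof -
    have "0 \<le> k * (\<rho> v + M)" "k * (\<rho> v + M) \<le> k * (2 * M)"
      using M(2)[OF that] k by (auto intro: mult_left_mono)
    moreover have "k * (2 * M) = b - a" using M(1) unfolding k_def by simp
    ultimately have "a \<le> r v" "r v \<le> b" unfolding r_def by auto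
    then show ?thesis
      using assms(1-3) unfolding is_interval_convex_1[symmetric] is_interval_1 by blast
  qed
  moreover have "dist (r u) (r v) \<le> k * \<delta> \<longleftrightarrow> dist (\<rho> u) (\<rho> v) \<le> \<delta>" for u v
  proof -
    have "r u - r v = k * (\<rho> u - \<rho> v)" unfolding r_def by (simp add: algebra_simps)
    then have "dist (r u) (r v) = k * dist (\<rho> u) (\<rho> v)"
      using k by (simp add: dist_real_def abs_mult)
    then show ?thesis using k by simp
  qed
  moreover have "k * \<delta> > 0" using k *(2) by simp
  ultimately show "G \<in> UBG (submetric euclidean_metric I)"
    using *(1,3) unfolding UBG_def unit_ball_graph_def
    by (auto intro!: exI[of _ "k * \<delta>"] exI[of _ r])
qed

text \<open>The edgeless graph on two vertices, realized on the line at 0 and 2 with threshold 1, is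
  not realizable on a single point, where every distance is below the threshold.\<close>

lemma UBG_real_two_points:
  assumes "(UBG (euclidean_metric :: real metric) :: ('v::infinite) graph set) \<subseteq> UBG X"
  obtains a b where "a \<in> mspace X" "b \<in> mspace X" "a \<noteq> b"
proof -
  obtain u v :: 'v where uv: "u \<noteq> v"
    using ex_new_if_finite[OF infinite_UNIV, of "{undefined :: 'v}"]
    by (metis finite.emptyI finite.insertI singletonI)
  have "({u, v}, {}) \<in> UBG (euclidean_metric :: real metric)"
    using uv unfolding UBG_def unit_ball_graph_def simple_graph_def
    by (auto intro!: exI[of _ "1::real"] exI[of _ "\<lambda>w. if w = u then 0 else 2"])
  then have "({u, v}, {}) \<in> UBG X" using assms by blast
  then obtain \<delta> \<rho> where *: "\<delta> > 0" "\<rho> u \<in> mspace X" "\<rho> v \<in> mspace X" "\<not> mdist X (\<rho> u) (\<rho> v) \<le> \<delta>"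
    using uv unfolding UBG_def unit_ball_graph_def by auto
  then have "\<rho> u \<noteq> \<rho> v" using mdist_zero[OF *(2,3)] by linarith
  with that * show ?thesis by blast
qed

theorem corollary1p13:
  fixes X :: "'a metric"
  assumes "mspace X \<noteq> {}" and "geodesic_space X"
  shows "(UBG X :: ('v::infinite) graph set) = UBG (euclidean_metric :: real metric) \<longleftrightarrow>
    (\<exists>I :: real set. convex I \<and> (\<nexists>a. I = {a}) \<and> isometric X (submetric euclidean_metric I))"
proof
  assume eq: "(UBG X :: 'v graph set) = UBG (euclidean_metric :: real metric)"
  \<comment> \<open>The inclusion of \<open>UBG\<close> of the reals in \<open>UBG X\<close>
    supplies two distinct points; the opposite inclusion supplies collinearity.\<close>
  obtain a b where ab: "a \<in> mspace X" "b \<in> mspace X" "a \<noteq> b"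
    using UBG_real_two_points[of X] eq by blast
  have "collinear_triples X"
    using UBG_real_collinear_triples[OF _ assms(2)] eq by blast
  then obtain f :: "'a \<Rightarrow> real" where
    f: "\<And>x y. x \<in> mspace X \<Longrightarrow> y \<in> mspace X \<Longrightarrow> \<bar>f x - f y\<bar> = mdist X x y"
    using collinear_triples_embedding[OF assms(2) _ ab] by blast
  have inj: "inj_on f (mspace X)"
    using f mdist_zero by (fastforce intro!: inj_onI)
  show "\<exists>I :: real set. convex I \<and> (\<nexists>a. I = {a}) \<and> isometric X (submetric euclidean_metric I)"
  proof (intro exI conjI)
    show "convex (f ` mspace X)" by (rule geodesic_space_embedding_convex[OF assms(2) f])
    show "\<nexists>c. f ` mspace X = {c}" using ab inj by (metis image_eqI inj_onD singletonD)
    show "isometric X (submetric euclidean_metric (f ` mspace X))"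
      unfolding isometric_def using f inj
      by (intro exI[of _ f]) (auto simp: bij_betw_def dist_real_def)
  qed
next
  assume "\<exists>I :: real set. convex I \<and> (\<nexists>a. I = {a}) \<and> isometric X (submetric euclidean_metric I)"
  then obtain I :: "real set" where I: "convex I" "\<nexists>a. I = {a}"
    "isometric X (submetric euclidean_metric I)" by blast
  \<comment> \<open>The condition on \<open>I\<close> excludes only singletons; the empty interval
    is ruled out because \<open>X\<close> has a point.\<close>
  have "I \<noteq> {}" using I(3) assms(1) unfolding isometric_def by (auto simp: bij_betw_def)
  then obtain a b where "a \<in> I" "b \<in> I" "a < b"
    using I(2) by (metis is_singletonI' is_singleton_the_elem linorder_neq_iff)
  then show "(UBG X :: 'v graph set) = UBG (euclidean_metric :: real metric)"
    using UBG_interval_eq_UBG_real[OF I(1), of a b] UBG_subset_isometric[OF I(3)]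
      UBG_subset_isometric[OF isometric_sym[OF I(3)]] by blast
qed

end
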